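(* Let $0<\rho<r$. There is a constant $C(\mathcal R(p,q),r,\rho)$, depending only on the growth bounds for $\mathcal R(p^n,q^n)$ given in the context, $r$ and $\rho$, such that for every $f\in\mathcal A_{\mathcal R(p,q),r}$ one has $\sup_{|z|\le\rho}|f(z)|\le C(\mathcal R(p,q),r,\rho)\,\|f\|_{\mathcal R(p,q),r}$ and, with the same constant, for every integer $m\ge0$, $$\sup_{|z|\le\rho}|f^{(m)}(z)|\le\frac{m!}{(r-\rho)^m}\,C(\mathcal R(p,q),r,\rho)\,\|f\|_{\mathcal R(p,q),r}.$$
   Context: $0<q<p\le1$, and $\mathcal R(u,v)=\sum_{s,t=-\ell}^{\infty}r_{st}u^sv^t$ (with $\ell\ge0$ an integer) is a deformation kernel such that $\mathcal R(p^n,q^n)>0$ for all integers $n\ge0$. Standing growth hypothesis: there exist constants $C_1,C_2>0$, $\Lambda\ge\lambda>0$ and $n_0\in\mathbb N$ such that $C_1e^{\lambda n}\le\mathcal R(p^n,q^n)\le C_2e^{\Lambda n}$ for all $n\ge n_0$. For $f(z)=\sum_{n\ge0}a_nz^n$ ($a_n\in\mathbb C$) analytic at the origin and $r>0$, $$\|f\|_{\mathcal R(p,q),r}:=\sum_{n=0}^\infty|a_n|\,\mathcal R(p^n,q^n)\,r^n,$$ and $\mathcal A_{\mathcal R(p,q),r}$ is the Banach space of power series with $\|f\|_{\mathcal R(p,q),r}<\infty$.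
   Formalization: The growth bounds control R(p^n,q^n) only for n ≥ n0, so no constant depending on them, r and ρ alone can exist; here C may also depend on given positive lower bounds for the finitely many values R(p^n,q^n) with n < n0. *)

theory Defs
  imports "HOL-Analysis.Analysis"
begin

(* The kernel R(u,v) = sum_{s,t >= -l} c s t * u^s * v^t. Convergence of the double series is
   unconditional convergence over the index set. *)

definition kernel_term ::
  "(int \<Rightarrow> int \<Rightarrow> complex) \<Rightarrow> complex \<Rightarrow> complex \<Rightarrow> int \<times> int \<Rightarrow> complex" where
  "kernel_term c u v = (\<lambda>(s, t). c s t * u powi s * v powi t)"

definition kernel_index :: "nat \<Rightarrow> (int \<times> int) set" where
  "kernel_index l = {- int l..} \<times> {- int l..}"

definition kernel ::
  "nat \<Rightarrow> (int \<Rightarrow> int \<Rightarrow> complex) \<Rightarrow> complex \<Rightarrow> complex \<Rightarrow> complex" where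
  "kernel l c u v = (\<Sum>\<^sub>\<infinity>x\<in>kernel_index l. kernel_term c u v x)"

definition kernel_at ::
  "real \<Rightarrow> real \<Rightarrow> nat \<Rightarrow> (int \<Rightarrow> int \<Rightarrow> complex) \<Rightarrow> nat \<Rightarrow> complex" where
  "kernel_at p q l c n = kernel l c (of_real (p ^ n)) (of_real (q ^ n))"

(* The coefficients are complex, so R(p^n,q^n) > 0 means that the value is real and positive. *)

definition deformation_kernel ::
  "real \<Rightarrow> real \<Rightarrow> nat \<Rightarrow> (int \<Rightarrow> int \<Rightarrow> complex) \<Rightarrow> bool" where
  "deformation_kernel p q l c \<longleftrightarrow>
     (\<forall>n. kernel_term c (of_real (p ^ n)) (of_real (q ^ n)) summable_on kernel_index l
          \<and> kernel_at p q l c n \<in> \<real> \<and> 0 < Re (kernel_at p q l c n))"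

(* The real number R(p^n,q^n) of a deformation kernel. *)

definition weight ::
  "real \<Rightarrow> real \<Rightarrow> nat \<Rightarrow> (int \<Rightarrow> int \<Rightarrow> complex) \<Rightarrow> nat \<Rightarrow> real" where
  "weight p q l c n = Re (kernel_at p q l c n)"

definition growth_bounds ::
  "real \<Rightarrow> real \<Rightarrow> real \<Rightarrow> real \<Rightarrow> nat \<Rightarrow> (nat \<Rightarrow> real) \<Rightarrow> bool" where
  "growth_bounds C1 C2 lam Lam n0 w \<longleftrightarrow>
     (\<forall>n\<ge>n0. C1 * exp (lam * real n) \<le> w n \<and> w n \<le> C2 * exp (Lam * real n))"

definition weighted_norm :: "(nat \<Rightarrow> real) \<Rightarrow> real \<Rightarrow> complex fps \<Rightarrow> real" where
  "weighted_norm w r f = (\<Sum>n. cmod (fps_nth f n) * w n * r ^ n)"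

(* A function analytic at the origin is represented by its Taylor series f, with values
   eval_fps f z. *)

definition weighted_space :: "(nat \<Rightarrow> real) \<Rightarrow> real \<Rightarrow> complex fps set" where
  "weighted_space w r =
     {f. 0 < fps_conv_radius f \<and> summable (\<lambda>n. cmod (fps_nth f n) * w n * r ^ n)}"

(* The supremum is taken in the extended reals, so that it is infinite (and not an unspecified
   real) when g is unbounded on the disc. *)

definition sup_on_disc :: "real \<Rightarrow> (complex \<Rightarrow> complex) \<Rightarrow> ereal" where
  "sup_on_disc \<rho> g = (SUP z\<in>cball 0 \<rho>. ereal (cmod (g z)))"

end

theory Submission
  imports Defs "HOL-Complex_Analysis.Cauchy_Integral_Formula"
begin

text \<open>
  The proof rests on two properties of the weights \<open>w n\<close>. They are bounded below by the least number
  \<open>d > 0\<close> among \<open>C1\<close> and the \<open>b n\<close> with \<open>n < n0\<close>, because \<open>C1 * exp (lam * n) \<ge> C1\<close>. And they grow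
  at least exponentially, so a finite weighted norm forces the Taylor series to converge on a disc
  of radius \<open>r * exp lam\<close>, strictly larger than \<open>r\<close> (lemma \<open>less_fps_conv_radius_if_growth\<close>).

  The first property bounds \<open>\<Sum>n. \<bar>a n\<bar> * r ^ n\<close>, and with it \<open>\<bar>f\<bar>\<close> on the whole closed disc of
  radius \<open>r\<close>, by \<open>1 / d\<close> times the weighted norm. The second makes \<open>f\<close> holomorphic on a neighbourhood
  of that closed disc. A point \<open>z\<close> with \<open>\<bar>z\<bar> \<le> \<rho>\<close> is the centre of a closed disc of radius exactly
  \<open>r - \<rho>\<close> inside it, and Cauchy's inequality there gives the factor \<open>m! / (r - \<rho>) ^ m\<close> with the
  same constant \<open>C = 1 / d\<close>; the bound on \<open>f\<close> itself is the case \<open>m = 0\<close>.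
\<close>

lemma cmod_eval_fps_le_suminf:
  fixes f :: "complex fps"
  assumes "summable (\<lambda>n. cmod (fps_nth f n) * r ^ n)" and "cmod z \<le> r"
  shows "cmod (eval_fps f z) \<le> (\<Sum>n. cmod (fps_nth f n) * r ^ n)"
  unfolding eval_fps_def
  using assms by (intro norm_suminf_le)
    (auto simp: norm_mult norm_power intro!: mult_left_mono power_mono)

text \<open>
  The radius of the disc on which Cauchy's inequality is used is the largest one for which the disc
  stays inside \<open>cball 0 r\<close> for every centre \<open>z\<close> in \<open>cball 0 \<rho>\<close>. It may touch the circle of radius
  \<open>r\<close>, which is why convergence is required beyond \<open>r\<close>.
\<close>

lemma cmod_higher_deriv_eval_fps_le:
  fixes f :: "complex fps"
  assumes radius: "ereal r < fps_conv_radius f" and "\<rho> < r" and "cmod z \<le> \<rho>"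
  shows "cmod ((deriv ^^ m) (eval_fps f) z)
           \<le> fact m / (r - \<rho>) ^ m * (\<Sum>n. cmod (fps_nth f n) * r ^ n)"
proof -
  have "r > 0" using assms(2,3) norm_ge_zero[of z] by linarith
  have sub: "cball z (r - \<rho>) \<subseteq> cball 0 r"
  proof
    fix x assume "x \<in> cball z (r - \<rho>)"
    then have "cmod (x - z) \<le> r - \<rho>" by (simp add: dist_norm norm_minus_commute)
    then show "x \<in> cball 0 r" using norm_triangle_sub[of x z] assms(3) by simp
  qed
  have "cball (0::complex) r \<subseteq> eball 0 (fps_conv_radius f)"
  proof
    fix x :: complex assume "x \<in> cball 0 r"
    then have "ereal (cmod x) \<le> ereal r" by simp
    then show "x \<in> eball 0 (fps_conv_radius f)" using le_less_trans[OF _ radius] by simp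
  qed
  with sub have hol: "eval_fps f holomorphic_on cball z (r - \<rho>)"
    by (intro holomorphic_on_eval_fps) blast
  have sums: "summable (\<lambda>n. cmod (fps_nth f n) * r ^ n)"
    using abs_summable_in_conv_radius[of "of_real r" "fps_nth f"] radius \<open>r > 0\<close>
    by (simp add: fps_conv_radius_def norm_mult norm_power)
  have "cmod ((deriv ^^ m) (eval_fps f) z)
          \<le> fact m * (\<Sum>n. cmod (fps_nth f n) * r ^ n) / (r - \<rho>) ^ m"
  proof (rule Cauchy_inequality)
    show "eval_fps f holomorphic_on ball z (r - \<rho>)"
      using hol ball_subset_cball by (rule holomorphic_on_subset)
    show "continuous_on (cball z (r - \<rho>)) (eval_fps f)"
      using hol by (rule holomorphic_on_imp_continuous_on)
    show "0 < r - \<rho>" using assms(2) by simp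
    fix x assume "cmod (z - x) = r - \<rho>"
    then have "x \<in> cball z (r - \<rho>)" by (simp add: dist_norm)
    then have "x \<in> cball 0 r" using sub by blast
    then show "cmod (eval_fps f x) \<le> (\<Sum>n. cmod (fps_nth f n) * r ^ n)"
      using sums by (intro cmod_eval_fps_le_suminf) auto
  qed
  then show ?thesis by simp
qed

lemma less_fps_conv_radius_if_growth:
  assumes f: "f \<in> weighted_space w r"
    and growth: "growth_bounds C1 C2 lam Lam n0 w"
    and "0 < C1" "0 < lam" "0 < r"
  shows "ereal r < fps_conv_radius f"
proof -
  define R where "R = r * exp lam"
  have "R > 0" "r < R" using assms(4,5) by (auto simp: R_def)
  have "summable (\<lambda>n. fps_nth f n * of_real R ^ n)"
  proof (rule summable_comparison_test)
    show "summable (\<lambda>n. cmod (fps_nth f n) * w n * r ^ n / C1)"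
      using f by (intro summable_divide) (simp add: weighted_space_def)
    show "\<exists>N. \<forall>n\<ge>N. cmod (fps_nth f n * of_real R ^ n) \<le> cmod (fps_nth f n) * w n * r ^ n / C1"
    proof (intro exI allI impI)
      fix n assume "n \<ge> n0"
      then have "exp (lam * real n) \<le> w n / C1"
        using growth \<open>0 < C1\<close> by (auto simp: growth_bounds_def field_simps)
      then have "cmod (fps_nth f n) * r ^ n * exp (lam * real n)
                   \<le> cmod (fps_nth f n) * r ^ n * (w n / C1)"
        using \<open>0 < r\<close> by (intro mult_left_mono) auto
      then show "cmod (fps_nth f n * of_real R ^ n) \<le> cmod (fps_nth f n) * w n * r ^ n / C1"
        using \<open>0 < r\<close>
        by (simp add: norm_mult norm_power R_def power_mult_distrib exp_of_nat2_mult[symmetric] mult_ac)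
    qed
  qed
  then have "ereal R \<le> fps_conv_radius f"
    using conv_radius_geI[of "fps_nth f" "of_real R"] \<open>R > 0\<close> by (simp add: fps_conv_radius_def)
  with \<open>r < R\<close> show ?thesis using less_le_trans[of "ereal r" "ereal R"] by simp
qed

lemma suminf_le_weighted_norm:
  assumes f: "f \<in> weighted_space w r" and "0 < d" "\<And>n. d \<le> w n" "0 \<le> r"
  shows "(\<Sum>n. cmod (fps_nth f n) * r ^ n) \<le> 1 / d * weighted_norm w r f"
proof -
  have le: "cmod (fps_nth f n) * r ^ n \<le> 1 / d * (cmod (fps_nth f n) * w n * r ^ n)" for n
    using mult_right_mono[OF assms(3)[of n], of "cmod (fps_nth f n) * r ^ n"] assms(2,4)
    by (simp add: field_simps)
  have sums: "summable (\<lambda>n. 1 / d * (cmod (fps_nth f n) * w n * r ^ n))"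
    using f by (intro summable_mult) (simp add: weighted_space_def)
  have "(\<Sum>n. cmod (fps_nth f n) * r ^ n) \<le> (\<Sum>n. 1 / d * (cmod (fps_nth f n) * w n * r ^ n))"
  proof (rule suminf_le[OF le _ sums])
    show "summable (\<lambda>n. cmod (fps_nth f n) * r ^ n)"
      using sums by (rule summable_comparison_test') (use le assms(4) in simp)
  qed
  also have "\<dots> = 1 / d * weighted_norm w r f"
    unfolding weighted_norm_def using f by (intro suminf_mult) (simp add: weighted_space_def)
  finally show ?thesis .
qed

(* The constant C is chosen before the kernel, from the growth bounds, r and rho. The growth bounds
   say nothing about n < n0, where positivity of R(p^n,q^n) enters through positive lower bounds b n
   (for a given kernel, b n = R(p^n,q^n) is admissible; for n0 = 0, b plays no role). *)

theorem corollary5: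
  fixes C1 C2 lam Lam r \<rho> :: real and n0 :: nat and b :: "nat \<Rightarrow> real"
  assumes "0 < C1" and "0 < C2" and "0 < lam" and "lam \<le> Lam"
    and "\<forall>n<n0. 0 < b n"
    and "0 < \<rho>" and "\<rho> < r"
  shows "\<exists>C::real. \<forall>(p::real) (q::real) (l::nat) (c :: int \<Rightarrow> int \<Rightarrow> complex).
           0 < q \<and> q < p \<and> p \<le> 1
           \<and> deformation_kernel p q l c
           \<and> growth_bounds C1 C2 lam Lam n0 (weight p q l c)
           \<and> (\<forall>n<n0. b n \<le> weight p q l c n)
           \<longrightarrow> (\<forall>f \<in> weighted_space (weight p q l c) r.
                 sup_on_disc \<rho> (eval_fps f) \<le> ereal (C * weighted_norm (weight p q l c) r f)
                 \<and> (\<forall>m::nat. sup_on_disc \<rho> ((deriv ^^ m) (eval_fps f))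
                       \<le> ereal (fact m / (r - \<rho>) ^ m * C * weighted_norm (weight p q l c) r f)))"
proof -
  define d where "d = Min (insert C1 (b ` {..<n0}))"
  have "d > 0" using assms(1,5) by (auto simp: d_def)
  have d_le: "d \<le> C1" "\<And>n. n < n0 \<Longrightarrow> d \<le> b n" by (auto simp: d_def)
  show ?thesis
  proof (rule exI[of _ "1 / d"], intro allI impI ballI, elim conjE)
    fix p q l c f
    let ?w = "weight p q l c"
    assume growth: "growth_bounds C1 C2 lam Lam n0 ?w" and early: "\<forall>n<n0. b n \<le> ?w n"
      and f: "f \<in> weighted_space ?w r"
    have "d \<le> ?w n" for n
    proof (cases "n < n0")
      case True
      then show ?thesis using early d_le(2) by force
    next
      case False
      have "d \<le> C1 * 1" using d_le by simp
      also have "\<dots> \<le> C1 * exp (lam * real n)"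
        using assms(1,3) by (intro mult_left_mono) auto
      also have "\<dots> \<le> ?w n" using growth False by (auto simp: growth_bounds_def)
      finally show ?thesis .
    qed
    then have sum_le: "(\<Sum>n. cmod (fps_nth f n) * r ^ n) \<le> 1 / d * weighted_norm ?w r f"
      using f \<open>0 < d\<close> assms(6,7) by (intro suminf_le_weighted_norm) auto
    have radius: "ereal r < fps_conv_radius f"
      using f growth assms by (intro less_fps_conv_radius_if_growth[of f ?w r C1 C2 lam Lam n0]) auto
    have bound: "sup_on_disc \<rho> ((deriv ^^ m) (eval_fps f))
             \<le> ereal (fact m / (r - \<rho>) ^ m * (1 / d) * weighted_norm ?w r f)" for m
      unfolding sup_on_disc_def
    proof (rule SUP_least)
      fix z :: complex assume "z \<in> cball 0 \<rho>"
      then have "cmod ((deriv ^^ m) (eval_fps f) z)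
                   \<le> fact m / (r - \<rho>) ^ m * (\<Sum>n. cmod (fps_nth f n) * r ^ n)"
        using radius assms(7) by (intro cmod_higher_deriv_eval_fps_le) auto
      also have "\<dots> \<le> fact m / (r - \<rho>) ^ m * (1 / d * weighted_norm ?w r f)"
        using sum_le assms(7) by (intro mult_left_mono) auto
      finally show "ereal (cmod ((deriv ^^ m) (eval_fps f) z))
                      \<le> ereal (fact m / (r - \<rho>) ^ m * (1 / d) * weighted_norm ?w r f)"
        by (simp add: mult.assoc)
    qed
    show "sup_on_disc \<rho> (eval_fps f) \<le> ereal (1 / d * weighted_norm ?w r f)
          \<and> (\<forall>m. sup_on_disc \<rho> ((deriv ^^ m) (eval_fps f))
                \<le> ereal (fact m / (r - \<rho>) ^ m * (1 / d) * weighted_norm ?w r f))"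
      using bound[of 0] bound by simp
  qed
qed

end
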